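(* Let $p\in M$. Then the sequence $\{p,f(p),f(f(p)),\ldots\}$ of iterates of the map $f:M\to M$ converges to the point $\left(\frac{\pi}{3},\frac{\pi}{3},\frac{\pi}{3}\right)$ (the equilateral triangle).
   Context: $M$ is the space of (nondegenerate, plane) triangles defined up to shifts, rotations and dilations. An element of $M$ is given by its triple of interior angles, i.e. a triple $(\alpha,\beta,\gamma)$ of positive numbers with $\alpha+\beta+\gamma=\pi$, where the triples $(\alpha,\beta,\gamma)$, $(\beta,\gamma,\alpha)$ and $(\gamma,\alpha,\beta)$ are identified (mirror symmetric triangles are in general different elements of $M$). Convergence is convergence of triples of angles, up to this cyclic identification. The map $f:M\to M$: represent $p=(\alpha,\beta,\gamma)\in M$ by a triangle of perimeter $\pi$ with these interior angles, and let $\alpha',\beta',\gamma'$ be the lengths of the edges opposite to the angles $\alpha,\beta,\gamma$, respectively. Then $f(p)=(\alpha',\beta',\gamma')$, i.e. $f(p)$ is the triangle whose interior angles are numerically equal to the edge lengths of the initial triangle of perimeter $\pi$. *)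

theory Defs
  imports "HOL-Analysis.Analysis"
begin

definition angle_triples :: "(real \<times> real \<times> real) set" where
  "angle_triples = {(\<alpha>, \<beta>, \<gamma>). 0 < \<alpha> \<and> 0 < \<beta> \<and> 0 < \<gamma> \<and> \<alpha> + \<beta> + \<gamma> = pi}"

definition cyclic_rel :: "((real \<times> real \<times> real) \<times> (real \<times> real \<times> real)) set" where
  "cyclic_rel = {((\<alpha>, \<beta>, \<gamma>), t). (\<alpha>, \<beta>, \<gamma>) \<in> angle_triples \<and>
      t \<in> {(\<alpha>, \<beta>, \<gamma>), (\<beta>, \<gamma>, \<alpha>), (\<gamma>, \<alpha>, \<beta>)}}"

(* The space M.  Reversing the cyclic order is not an identification, so mirror images are
   in general different points. *)
definition triangle_space :: "(real \<times> real \<times> real) set set" where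
  "triangle_space = angle_triples // cyclic_rel"

definition triangle_class :: "real \<times> real \<times> real \<Rightarrow> (real \<times> real \<times> real) set" where
  "triangle_class t = cyclic_rel `` {t}"

definition triangle_tendsto ::
    "(nat \<Rightarrow> (real \<times> real \<times> real) set) \<Rightarrow> (real \<times> real \<times> real) set \<Rightarrow> bool" where
  "triangle_tendsto P q \<longleftrightarrow> (\<exists>x y. (\<forall>n. x n \<in> P n) \<and> y \<in> q \<and> x \<longlonglongrightarrow> y)"

(* Plane triangles have their vertices in the complex plane.  The condition says that A, B, C
   are the vertices of a nondegenerate triangle in counterclockwise order: the imaginary part
   is twice the signed area. *)
definition ccw_triangle :: "complex \<Rightarrow> complex \<Rightarrow> complex \<Rightarrow> bool" where
  "ccw_triangle A B C \<longleftrightarrow> 0 < Im (cnj (B - A) * (C - A))"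

(* the unoriented angle between the rays from A through B and from A through C *)
definition angle_at :: "complex \<Rightarrow> complex \<Rightarrow> complex \<Rightarrow> real" where
  "angle_at A B C = arccos (((B - A) \<bullet> (C - A)) / (norm (B - A) * norm (C - A)))"

definition interior_angles :: "complex \<Rightarrow> complex \<Rightarrow> complex \<Rightarrow> real \<times> real \<times> real" where
  "interior_angles A B C = (angle_at A B C, angle_at B C A, angle_at C A B)"

(* the i-th edge is opposite to the i-th angle of interior_angles *)
definition edge_lengths :: "complex \<Rightarrow> complex \<Rightarrow> complex \<Rightarrow> real \<times> real \<times> real" where
  "edge_lengths A B C = (dist B C, dist C A, dist A B)"

definition perimeter :: "complex \<Rightarrow> complex \<Rightarrow> complex \<Rightarrow> real" where
  "perimeter A B C = dist B C + dist C A + dist A B"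

(* The map f: M -> M.  It is well defined on M, see edge_map_ex1 and edge_map_in_space. *)
definition edge_map :: "(real \<times> real \<times> real) set \<Rightarrow> (real \<times> real \<times> real) set" where
  "edge_map p = (THE q. \<exists>A B C. ccw_triangle A B C \<and> perimeter A B C = pi \<and>
      interior_angles A B C \<in> p \<and> q = triangle_class (edge_lengths A B C))"

lemma angle_at_props:
  assumes "ccw_triangle A B C"
  shows "norm (B - A) * norm (C - A) * cos (angle_at A B C) = (B - A) \<bullet> (C - A)"
    and "norm (B - A) * norm (C - A) * sin (angle_at A B C) = Im (cnj (B - A) * (C - A))"
proof -
  define u v where "u = B - A" and "v = C - A"
  have pos: "0 < Im (cnj u * v)" using assms by (simp add: ccw_triangle_def u_def v_def)
  hence "u \<noteq> 0" "v \<noteq> 0" by auto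
  hence n: "0 < norm u * norm v" by simp
  define t where "t = (u \<bullet> v) / (norm u * norm v)"
  have "\<bar>u \<bullet> v\<bar> \<le> norm u * norm v" by (rule Cauchy_Schwarz_ineq2)
  hence t: "-1 \<le> t" "t \<le> 1" using n by (auto simp: t_def field_simps abs_le_iff)
  have c: "norm u * norm v * cos (arccos t) = u \<bullet> v"
    using t n by (simp add: cos_arccos t_def)
  have s0: "0 \<le> sin (arccos t)" using t by (intro sin_ge_zero arccos_lbound arccos_ubound)
  have "(norm u * norm v * sin (arccos t))\<^sup>2 + (norm u * norm v * cos (arccos t))\<^sup>2 = (norm u * norm v)\<^sup>2"
    by (simp add: power_mult_distrib sin_squared_eq algebra_simps)
  moreover have "(u \<bullet> v)\<^sup>2 + (Im (cnj u * v))\<^sup>2 = (norm u * norm v)\<^sup>2"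
    unfolding power_mult_distrib cmod_power2 inner_complex_def
    by (simp add: power2_eq_square algebra_simps)
  ultimately have "(norm u * norm v * sin (arccos t))\<^sup>2 = (Im (cnj u * v))\<^sup>2"
    unfolding c by (metis add.commute add_left_cancel)
  hence s: "norm u * norm v * sin (arccos t) = Im (cnj u * v)"
    by (rule power2_eq_imp_eq) (use s0 pos n in simp_all)
  show "norm (B - A) * norm (C - A) * cos (angle_at A B C) = (B - A) \<bullet> (C - A)"
    using c by (simp add: angle_at_def t_def u_def v_def)
  show "norm (B - A) * norm (C - A) * sin (angle_at A B C) = Im (cnj (B - A) * (C - A))"
    using s by (simp add: angle_at_def t_def u_def v_def)
qed

lemma edge_lengths_law_of_sines:
  assumes "ccw_triangle A B C" "perimeter A B C = pi"
    and "interior_angles A B C = (\<alpha>, \<beta>, \<gamma>)"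
  defines "s \<equiv> sin \<alpha> + sin \<beta> + sin \<gamma>"
  shows "edge_lengths A B C = (pi * sin \<alpha> / s, pi * sin \<beta> / s, pi * sin \<gamma> / s)"
proof -
  define D where "D = Im (cnj (B - A) * (C - A))"
  define a b c where "a = dist B C" and "b = dist C A" and "c = dist A B"
  have D: "0 < D" using assms(1) by (simp add: ccw_triangle_def D_def)
  have D2: "Im (cnj (C - B) * (A - B)) = D" and D3: "Im (cnj (A - C) * (B - C)) = D"
    by (simp_all add: D_def algebra_simps)
  have ccw: "ccw_triangle B C A" "ccw_triangle C A B"
    unfolding ccw_triangle_def D2 D3 by (fact D)+
  have ang: "\<alpha> = angle_at A B C" "\<beta> = angle_at B C A" "\<gamma> = angle_at C A B"
    using assms(3) by (simp_all add: interior_angles_def)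
  have s1: "c * b * sin \<alpha> = D"
    using angle_at_props(2)[OF assms(1)]
    by (simp add: ang D_def a_def b_def c_def dist_norm norm_minus_commute)
  have s2: "a * c * sin \<beta> = D"
    using angle_at_props(2)[OF ccw(1)] unfolding D2
    by (simp add: ang a_def b_def c_def dist_norm norm_minus_commute)
  have s3: "b * a * sin \<gamma> = D"
    using angle_at_props(2)[OF ccw(2)] unfolding D3
    by (simp add: ang a_def b_def c_def dist_norm norm_minus_commute)
  have "a \<ge> 0" "b \<ge> 0" "c \<ge> 0" by (simp_all add: a_def b_def c_def)
  moreover have "a \<noteq> 0" "b \<noteq> 0" "c \<noteq> 0" using s1 s2 s3 D by auto
  ultimately have abc: "a > 0" "b > 0" "c > 0" by auto
  define k where "k = a * b * c / D"
  have k: "k > 0" using abc D by (simp add: k_def)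
  have "k * sin \<alpha> * D = a * (c * b * sin \<alpha>)" "k * sin \<beta> * D = b * (a * c * sin \<beta>)"
    "k * sin \<gamma> * D = c * (b * a * sin \<gamma>)"
    using D by (simp_all add: k_def)
  hence e: "a = k * sin \<alpha>" "b = k * sin \<beta>" "c = k * sin \<gamma>"
    unfolding s1 s2 s3 using D by simp_all
  have "k * s = pi"
    using assms(2) e by (simp add: perimeter_def a_def b_def c_def s_def algebra_simps)
  moreover from this have "s \<noteq> 0" by auto
  ultimately have "k = pi / s" by (simp add: eq_divide_eq)
  thus ?thesis using e by (simp add: edge_lengths_def a_def b_def c_def)
qed

lemma triangle_exists:
  assumes "(\<alpha>, \<beta>, \<gamma>) \<in> angle_triples"
  shows "\<exists>A B C. ccw_triangle A B C \<and> perimeter A B C = pi \<and> interior_angles A B C = (\<alpha>, \<beta>, \<gamma>)"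
proof -
  have pos: "0 < \<alpha>" "0 < \<beta>" "0 < \<gamma>" and sum: "\<alpha> + \<beta> + \<gamma> = pi"
    using assms by (auto simp: angle_triples_def)
  have sp: "0 < sin \<alpha>" "0 < sin \<beta>" "0 < sin \<gamma>"
    using pos sum by (auto intro!: sin_gt_zero)
  define k where "k = pi / (sin \<alpha> + sin \<beta> + sin \<gamma>)"
  have k: "k > 0" "k * (sin \<alpha> + sin \<beta> + sin \<gamma>) = pi" using sp by (auto simp: k_def)
  define a b c where "a = k * sin \<alpha>" and "b = k * sin \<beta>" and "c = k * sin \<gamma>"
  have abc: "a > 0" "b > 0" "c > 0" using k sp by (auto simp: a_def b_def c_def)
  have g: "\<gamma> = pi - (\<alpha> + \<beta>)" using sum by simp
  have c: "c = b * cos \<alpha> + a * cos \<beta>"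
    unfolding c_def a_def b_def g by (simp add: sin_diff sin_add algebra_simps)
  have ba: "b * sin \<alpha> = a * sin \<beta>" by (simp add: a_def b_def)
  define A B C where "A = (0::complex)" and "B = complex_of_real c" and "C = of_real b * cis \<alpha>"
  have BA: "B - A = of_real c * cis 0" by (simp add: A_def B_def)
  have CA: "C - A = of_real b * cis \<alpha>" by (simp add: A_def C_def)
  have CB: "C - B = of_real a * cis (pi - \<beta>)"
    by (simp add: B_def C_def complex_eq_iff c ba)
  have nBA: "norm (B - A) = c" and nCA: "norm (C - A) = b" and nCB: "norm (C - B) = a"
    unfolding BA CA CB using abc by (simp_all add: norm_mult)
  have n': "norm (A - B) = c" "norm (A - C) = b" "norm (B - C) = a"
    using nBA nCA nCB by (simp_all add: norm_minus_commute)
  have i1: "(B - A) \<bullet> (C - A) = c * b * cos \<alpha>"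
    unfolding BA CA by (simp add: inner_complex_def)
  have i2: "(C - B) \<bullet> (A - B) = a * c * cos \<beta>"
  proof -
    have "A - B = - (of_real c * cis 0)" using BA by (simp add: algebra_simps)
    thus ?thesis unfolding CB by (simp add: inner_complex_def)
  qed
  have i3: "(A - C) \<bullet> (B - C) = b * a * cos \<gamma>"
  proof -
    have "(A - C) \<bullet> (B - C) = (C - A) \<bullet> (C - B)" by (simp add: inner_diff_left inner_diff_right)
    thus ?thesis unfolding CA CB g
      by (simp add: inner_complex_def cos_diff cos_add algebra_simps)
  qed
  have "interior_angles A B C = (\<alpha>, \<beta>, \<gamma>)"
    unfolding interior_angles_def angle_at_def i1 i2 i3 nBA nCA nCB n'
    using abc pos sum by (simp add: arccos_cos)
  moreover have "perimeter A B C = pi"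
    using nBA n' nCA k(2) unfolding perimeter_def dist_norm
    by (simp add: a_def b_def c_def algebra_simps)
  moreover have "ccw_triangle A B C"
    unfolding ccw_triangle_def BA CA using abc sp by simp
  ultimately show ?thesis by blast
qed

lemma triangle_class_rotate:
  "triangle_class (\<beta>, \<gamma>, \<alpha>) = triangle_class (\<alpha>, \<beta>, \<gamma>)"
  unfolding triangle_class_def cyclic_rel_def angle_triples_def by auto

lemma edge_map_ex1:
  assumes "p \<in> triangle_space"
  shows "\<exists>!q. \<exists>A B C. ccw_triangle A B C \<and> perimeter A B C = pi \<and>
      interior_angles A B C \<in> p \<and> q = triangle_class (edge_lengths A B C)"
proof -
  obtain \<alpha> \<beta> \<gamma> where t: "(\<alpha>, \<beta>, \<gamma>) \<in> angle_triples" and p: "p = cyclic_rel `` {(\<alpha>, \<beta>, \<gamma>)}"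
    using assms by (auto simp: triangle_space_def quotient_def)
  have p': "p = {(\<alpha>, \<beta>, \<gamma>), (\<beta>, \<gamma>, \<alpha>), (\<gamma>, \<alpha>, \<beta>)}"
    unfolding p cyclic_rel_def using t by auto
  define s where "s = sin \<alpha> + sin \<beta> + sin \<gamma>"
  define T where "T = triangle_class (pi * sin \<alpha> / s, pi * sin \<beta> / s, pi * sin \<gamma> / s)"
  have T: "triangle_class (edge_lengths A B C) = T"
    if h: "ccw_triangle A B C" "perimeter A B C = pi" "interior_angles A B C \<in> p" for A B C
  proof -
    note law = edge_lengths_law_of_sines[OF h(1,2)]
    have s': "sin \<beta> + sin \<gamma> + sin \<alpha> = s" "sin \<gamma> + sin \<alpha> + sin \<beta> = s" by (simp_all add: s_def)
    consider "interior_angles A B C = (\<alpha>, \<beta>, \<gamma>)" | "interior_angles A B C = (\<beta>, \<gamma>, \<alpha>)"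
      | "interior_angles A B C = (\<gamma>, \<alpha>, \<beta>)"
      using h(3) unfolding p' by blast
    thus ?thesis
    proof cases
      case 1
      show ?thesis unfolding law[OF 1] T_def s_def by (rule refl)
    next
      case 2
      show ?thesis unfolding law[OF 2] s' T_def by (rule triangle_class_rotate)
    next
      case 3
      show ?thesis unfolding law[OF 3] s' T_def by (rule triangle_class_rotate[symmetric])
    qed
  qed
  obtain A B C where h: "ccw_triangle A B C" "perimeter A B C = pi" "interior_angles A B C \<in> p"
    using triangle_exists[OF t] p' by (metis insertI1)
  show ?thesis
  proof (rule ex1I[of _ T])
    show "\<exists>A B C. ccw_triangle A B C \<and> perimeter A B C = pi \<and> interior_angles A B C \<in> p \<and>
        T = triangle_class (edge_lengths A B C)"
      by (rule exI[of _ A], rule exI[of _ B], rule exI[of _ C]) (simp only: h T[OF h] simp_thms)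
  next
    fix q
    assume "\<exists>A B C. ccw_triangle A B C \<and> perimeter A B C = pi \<and> interior_angles A B C \<in> p \<and>
        q = triangle_class (edge_lengths A B C)"
    thus "q = T" by (elim exE conjE) (simp only: T)
  qed
qed

lemma edge_map_in_space:
  assumes "p \<in> triangle_space"
  shows "edge_map p \<in> triangle_space"
proof -
  have "\<exists>A B C. ccw_triangle A B C \<and> perimeter A B C = pi \<and> interior_angles A B C \<in> p \<and>
      edge_map p = triangle_class (edge_lengths A B C)"
    unfolding edge_map_def by (rule theI'[OF edge_map_ex1[OF assms]])
  then obtain A B C where h: "ccw_triangle A B C" "perimeter A B C = pi"
    "edge_map p = triangle_class (edge_lengths A B C)" by (elim exE conjE)
  have "A \<noteq> B" "B \<noteq> C" "C \<noteq> A"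
    using h(1) by (auto simp: ccw_triangle_def algebra_simps)
  hence "edge_lengths A B C \<in> angle_triples"
    using h(2) by (simp add: edge_lengths_def angle_triples_def perimeter_def)
  thus ?thesis
    unfolding h(3) triangle_class_def triangle_space_def by (rule quotientI)
qed

end

theory Submission
  imports Defs
begin

text \<open>
  By the law of sines, \<open>edge_map\<close> replaces the angles by numbers proportional to their sines, so
  the ratio of two angles \<open>x\<close> and \<open>y\<close> becomes \<open>sin x / sin y\<close>.  In a triangle the larger angle
  has the larger sine, so a ratio that is at least 1 stays at least 1
  (\<open>sin_less_sin_of_triangle_angles\<close>); and because \<open>sin x / x\<close> decreases on \<open>(0, \<pi>)\<close>, such a
  ratio can only shrink (\<open>mult_sin_less_mult_sin\<close>).  Hence each ratio of angles moves
  monotonically towards 1 and converges to a positive limit (\<open>angle_ratio_tendsto\<close>).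

  Since the angles sum to \<open>\<pi>\<close>, they are continuous functions of their ratios, so they
  converge as well, to positive limits with sum \<open>\<pi>\<close>.  Passing to the limit in the recursion
  shows that limits \<open>a\<close>, \<open>b\<close> of two angles satisfy \<open>a sin b = b sin a\<close>, and the strict
  monotonicity of \<open>sin x / x\<close> forces \<open>a = b\<close>.  So the limit is equilateral.
\<close>

section \<open>Comparing the sines of two angles\<close>

text \<open>
  This is the strict decrease of \<open>sin x / x\<close>.  The numerator \<open>sin t - t cos t\<close> of its negated
  derivative is positive because it vanishes at 0 and has derivative \<open>t sin t\<close>.
\<close>

lemma mult_sin_less_mult_sin:
  fixes x y :: real
  assumes "0 < y" "y < x" "x < pi"
  shows "y * sin x < x * sin y"
proof -
  have numerator_pos: "0 < sin t - t * cos t" if "0 < t" "t < pi" for t :: real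
  proof -
    have "(\<lambda>t. sin t - t * cos t) 0 < (\<lambda>t. sin t - t * cos t) t"
    proof (rule DERIV_pos_imp_increasing_open[OF \<open>0 < t\<close>])
      fix u :: real
      assume u: "0 < u" "u < t"
      have "((\<lambda>t. sin t - t * cos t) has_real_derivative u * sin u) (at u)"
        by (auto intro!: derivative_eq_intros)
      moreover have "0 < u * sin u"
        using u that by (intro mult_pos_pos sin_gt_zero) auto
      ultimately show "\<exists>d. ((\<lambda>t. sin t - t * cos t) has_real_derivative d) (at u) \<and> 0 < d"
        by blast
    qed (intro continuous_intros)
    thus ?thesis by simp
  qed
  have "(\<lambda>t. sin t / t) x < (\<lambda>t. sin t / t) y"
  proof (rule DERIV_neg_imp_decreasing[OF \<open>y < x\<close>])
    fix t :: real
    assume t: "y \<le> t" "t \<le> x"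
    hence "((\<lambda>t. sin t / t) has_real_derivative (cos t * t - sin t) / (t * t)) (at t)"
      using assms by (auto intro!: derivative_eq_intros)
    moreover have "(cos t * t - sin t) / (t * t) < 0"
      using numerator_pos[of t] t assms by (intro divide_neg_pos) (auto simp: mult.commute)
    ultimately show "\<exists>d. ((\<lambda>t. sin t / t) has_real_derivative d) (at t) \<and> d < 0"
      by blast
  qed
  thus ?thesis using assms by (simp add: field_simps)
qed

lemma sin_less_sin_of_triangle_angles:
  fixes x y :: real
  assumes "0 < y" "y < x" "x + y < pi"
  shows "sin y < sin x"
proof -
  have "0 < sin ((x - y) / 2)" using assms by (intro sin_gt_zero) auto
  moreover have "0 < cos ((x + y) / 2)" using assms by (intro cos_gt_zero) auto
  ultimately have "0 < 2 * sin ((x - y) / 2) * cos ((x + y) / 2)" by simp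
  thus ?thesis using sin_diff_sin[of x y] by linarith
qed

section \<open>Ratios of angles along an orbit\<close>

text \<open>
  The order of the two angles is preserved, so the ratio \<open>x n / y n\<close> stays at least 1; it is
  nonincreasing and therefore converges, to a limit that is again at least 1.
\<close>

lemma angle_ratio_tendsto_ordered:
  fixes x y :: "nat \<Rightarrow> real"
  assumes pos: "\<And>n. 0 < x n" "\<And>n. 0 < y n" and less_pi: "\<And>n. x n + y n < pi"
    and step: "\<And>n. x (Suc n) / y (Suc n) = sin (x n) / sin (y n)"
    and "y 0 \<le> x 0"
  shows "\<exists>l > 0. (\<lambda>n. x n / y n) \<longlonglongrightarrow> l"
proof -
  have sin_pos: "0 < sin (x n)" "0 < sin (y n)" for n
    using pos[of n] less_pi[of n] by (auto intro!: sin_gt_zero)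
  have ordered: "y n \<le> x n" for n
  proof (induction n)
    case 0
    show ?case by fact
  next
    case (Suc n)
    have "sin (y n) \<le> sin (x n)"
      using sin_less_sin_of_triangle_angles[of "y n" "x n"] Suc pos less_pi
      by (cases "y n = x n") (auto simp: less_imp_le)
    hence "1 \<le> x (Suc n) / y (Suc n)" unfolding step using sin_pos by simp
    thus ?case using pos by simp
  qed
  have "x (Suc n) / y (Suc n) \<le> x n / y n" for n
  proof -
    have "x n < pi" using less_pi[of n] pos(2)[of n] by linarith
    hence "y n * sin (x n) \<le> x n * sin (y n)"
      using mult_sin_less_mult_sin[of "y n" "x n"] ordered[of n] pos
      by (cases "y n = x n") (auto simp: less_imp_le)
    thus ?thesis unfolding step using pos sin_pos by (simp add: field_simps)
  qed
  hence "decseq (\<lambda>n. x n / y n)" by (rule decseq_SucI)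
  moreover have ge_1: "1 \<le> x n / y n" for n using ordered pos by simp
  ultimately obtain l where l: "(\<lambda>n. x n / y n) \<longlonglongrightarrow> l"
    using decseq_convergent by blast
  moreover have "1 \<le> l" using ge_1 by (intro LIMSEQ_le_const[OF l]) auto
  ultimately show ?thesis by (intro exI[of _ l]) auto
qed

lemma angle_ratio_tendsto:
  fixes x y :: "nat \<Rightarrow> real"
  assumes pos: "\<And>n. 0 < x n" "\<And>n. 0 < y n" and less_pi: "\<And>n. x n + y n < pi"
    and step: "\<And>n. x (Suc n) / y (Suc n) = sin (x n) / sin (y n)"
  shows "\<exists>l > 0. (\<lambda>n. x n / y n) \<longlonglongrightarrow> l"
proof (cases "y 0 \<le> x 0")
  case True
  thus ?thesis using angle_ratio_tendsto_ordered[of x y] assms by blast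
next
  case False
  have "y (Suc n) / x (Suc n) = sin (y n) / sin (x n)" for n
    using arg_cong[OF step[of n], of inverse] by simp
  moreover have "y n + x n < pi" for n using less_pi[of n] by (simp add: add.commute)
  ultimately obtain l where "l > 0" "(\<lambda>n. y n / x n) \<longlonglongrightarrow> l"
    using angle_ratio_tendsto_ordered[of y x] pos False by auto
  hence "(\<lambda>n. inverse (y n / x n)) \<longlonglongrightarrow> inverse l" "0 < inverse l"
    by (intro tendsto_inverse, simp_all)
  thus ?thesis unfolding inverse_divide by blast
qed

text \<open>
  Since \<open>a\<close> and \<open>b\<close> lie strictly between 0 and \<open>\<pi>\<close>, the recursion passes to the limit and gives
  \<open>a / b = sin a / sin b\<close>; the strict decrease of \<open>sin x / x\<close> leaves only equality.
\<close>

lemma angle_limits_equal: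
  fixes x y :: "nat \<Rightarrow> real"
  assumes lim: "x \<longlonglongrightarrow> a" "y \<longlonglongrightarrow> b" and ab: "0 < a" "0 < b" "a + b < pi"
    and step: "\<And>n. x (Suc n) / y (Suc n) = sin (x n) / sin (y n)"
  shows "a = b"
proof -
  have "sin b > 0" using ab by (intro sin_gt_zero) auto
  have "(\<lambda>n. x (Suc n) / y (Suc n)) \<longlonglongrightarrow> a / b"
    using lim ab by (intro tendsto_divide LIMSEQ_Suc) auto
  moreover have "(\<lambda>n. sin (x n) / sin (y n)) \<longlonglongrightarrow> sin a / sin b"
    using lim \<open>sin b > 0\<close> by (intro tendsto_divide tendsto_sin) auto
  ultimately have "a / b = sin a / sin b"
    unfolding step by (rule LIMSEQ_unique)
  hence "a * sin b = b * sin a" using ab \<open>sin b > 0\<close> by (simp add: field_simps)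
  thus ?thesis
    using mult_sin_less_mult_sin[of a b] mult_sin_less_mult_sin[of b a] ab
    by (cases a b rule: linorder_cases) auto
qed

text \<open>
  The angles are recovered from their ratios to the third one: \<open>z = \<pi> / (x / z + y / z + 1)\<close>.
\<close>

lemma angles_tendsto_third_pi:
  fixes x y z :: "nat \<Rightarrow> real"
  assumes pos: "\<And>n. 0 < x n" "\<And>n. 0 < y n" "\<And>n. 0 < z n"
    and sum: "\<And>n. x n + y n + z n = pi"
    and step_xz: "\<And>n. x (Suc n) / z (Suc n) = sin (x n) / sin (z n)"
    and step_yz: "\<And>n. y (Suc n) / z (Suc n) = sin (y n) / sin (z n)"
  shows "x \<longlonglongrightarrow> pi / 3" "y \<longlonglongrightarrow> pi / 3" "z \<longlonglongrightarrow> pi / 3"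
proof -
  have "x n + z n < pi" "y n + z n < pi" for n
    using pos(1,2)[of n] sum[of n] by linarith+
  then obtain l m where l: "l > 0" "(\<lambda>n. x n / z n) \<longlonglongrightarrow> l"
    and m: "m > 0" "(\<lambda>n. y n / z n) \<longlonglongrightarrow> m"
    using angle_ratio_tendsto[of x z] angle_ratio_tendsto[of y z] pos step_xz step_yz
    by blast
  define c where "c = pi / (l + m + 1)"
  have c: "c > 0" using l(1) m(1) by (simp add: c_def)
  have z_eq: "z n = pi / (x n / z n + y n / z n + 1)" for n
  proof -
    have "x n / z n + y n / z n + 1 = pi / z n"
      using pos(3)[of n] unfolding sum[of n, symmetric] by (simp add: field_simps)
    thus ?thesis using pos(3)[of n] by simp
  qed
  have "(\<lambda>n. pi / (x n / z n + y n / z n + 1)) \<longlonglongrightarrow> c"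
    unfolding c_def using l m by (intro tendsto_intros) auto
  hence z: "z \<longlonglongrightarrow> c" unfolding z_eq[symmetric] .
  have "(\<lambda>n. x n / z n * z n) \<longlonglongrightarrow> l * c" "(\<lambda>n. y n / z n * z n) \<longlonglongrightarrow> m * c"
    by (intro tendsto_mult l(2) m(2) z)+
  hence x: "x \<longlonglongrightarrow> l * c" and y: "y \<longlonglongrightarrow> m * c"
    using pos(3) by (simp_all add: less_imp_neq[THEN not_sym])
  have "c * (l + m + 1) = pi" using l(1) m(1) by (simp add: c_def)
  hence sum_lim: "l * c + m * c + c = pi" by (simp add: algebra_simps)
  have lim_pos: "0 < l * c" "0 < m * c" using l(1) m(1) c by simp_all
  have eq: "l * c = c" "m * c = c"
    using angle_limits_equal[OF x z lim_pos(1) c _ step_xz]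
      angle_limits_equal[OF y z lim_pos(2) c _ step_yz] sum_lim lim_pos
    by auto
  hence "c = pi / 3" using sum_lim by linarith
  thus "x \<longlonglongrightarrow> pi / 3" "y \<longlonglongrightarrow> pi / 3" "z \<longlonglongrightarrow> pi / 3"
    using x[unfolded eq] y[unfolded eq] z by metis+
qed

section \<open>The map on angle triples\<close>

text \<open>
  A lift of \<open>edge_map\<close> from the quotient to triples of angles, so that an orbit of triangle
  classes has a coherent choice of representatives.
\<close>

definition sine_map :: "real \<times> real \<times> real \<Rightarrow> real \<times> real \<times> real" where
  "sine_map = (\<lambda>(\<alpha>, \<beta>, \<gamma>). let s = sin \<alpha> + sin \<beta> + sin \<gamma>
     in (pi * sin \<alpha> / s, pi * sin \<beta> / s, pi * sin \<gamma> / s))"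

lemma mem_triangle_class: "t \<in> angle_triples \<Longrightarrow> t \<in> triangle_class t"
  by (cases t) (auto simp: triangle_class_def cyclic_rel_def)

lemma sines_pos:
  assumes "(\<alpha>, \<beta>, \<gamma>) \<in> angle_triples"
  shows "0 < sin \<alpha>" "0 < sin \<beta>" "0 < sin \<gamma>"
  using assms by (auto simp: angle_triples_def intro!: sin_gt_zero)

lemma sine_map_in_angle_triples:
  assumes "t \<in> angle_triples"
  shows "sine_map t \<in> angle_triples"
proof -
  obtain \<alpha> \<beta> \<gamma> where t: "t = (\<alpha>, \<beta>, \<gamma>)" by (cases t)
  define s where "s = sin \<alpha> + sin \<beta> + sin \<gamma>"
  note sp = sines_pos[OF assms[unfolded t]]
  hence "s > 0" by (simp add: s_def)
  moreover have "pi * sin \<alpha> / s + pi * sin \<beta> / s + pi * sin \<gamma> / s = pi * s / s"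
    by (simp add: s_def add_divide_distrib distrib_left)
  ultimately show ?thesis
    using sp by (simp add: t sine_map_def Let_def angle_triples_def flip: s_def)
qed

lemma edge_map_triangle_class:
  assumes "t \<in> angle_triples"
  shows "edge_map (triangle_class t) = triangle_class (sine_map t)"
proof -
  obtain \<alpha> \<beta> \<gamma> where t: "t = (\<alpha>, \<beta>, \<gamma>)" by (cases t)
  obtain A B C where ABC: "ccw_triangle A B C" "perimeter A B C = pi"
    "interior_angles A B C = (\<alpha>, \<beta>, \<gamma>)"
    using triangle_exists assms unfolding t by blast
  have "edge_lengths A B C = sine_map t"
    using edge_lengths_law_of_sines[OF ABC] by (simp add: t sine_map_def Let_def)
  moreover have "interior_angles A B C \<in> triangle_class t"
    using mem_triangle_class[OF assms] ABC(3) by (simp add: t)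
  moreover have "triangle_class t \<in> triangle_space"
    using assms unfolding triangle_class_def triangle_space_def by (rule quotientI)
  ultimately show ?thesis
    unfolding edge_map_def using ABC(1,2) by (intro the1_equality edge_map_ex1) metis+
qed

lemma sine_map_orbit_tendsto:
  assumes "t \<in> angle_triples"
  shows "(\<lambda>n. (sine_map ^^ n) t) \<longlonglongrightarrow> (pi / 3, pi / 3, pi / 3)"
proof -
  define x y z where "x n = fst ((sine_map ^^ n) t)" and "y n = fst (snd ((sine_map ^^ n) t))"
    and "z n = snd (snd ((sine_map ^^ n) t))" for n
  have orbit: "(sine_map ^^ n) t = (x n, y n, z n)" for n
    by (simp add: x_def y_def z_def)
  have "(sine_map ^^ n) t \<in> angle_triples" for n
    by (induction n) (simp_all add: assms sine_map_in_angle_triples)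
  hence triple: "(x n, y n, z n) \<in> angle_triples" for n by (simp add: orbit)
  hence pos: "0 < x n" "0 < y n" "0 < z n" and sum: "x n + y n + z n = pi" for n
    by (auto simp: angle_triples_def)
  have next_triple: "(x (Suc n), y (Suc n), z (Suc n)) = sine_map (x n, y n, z n)" for n
    by (simp flip: orbit)
  have step: "x (Suc n) / z (Suc n) = sin (x n) / sin (z n)"
    "y (Suc n) / z (Suc n) = sin (y n) / sin (z n)" for n
  proof -
    have "sin (x n) + sin (y n) + sin (z n) > 0"
      using sines_pos[OF triple[of n]] by simp
    thus "x (Suc n) / z (Suc n) = sin (x n) / sin (z n)"
      "y (Suc n) / z (Suc n) = sin (y n) / sin (z n)"
      using next_triple[of n] by (simp_all add: sine_map_def Let_def)
  qed
  show ?thesis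
    unfolding orbit using angles_tendsto_third_pi[of x y z] pos sum step by (intro tendsto_Pair) blast+
qed

theorem theorem2p1:
  fixes p :: "(real \<times> real \<times> real) set"
  assumes "p \<in> triangle_space"
  shows "triangle_tendsto (\<lambda>n. (edge_map ^^ n) p) (triangle_class (pi / 3, pi / 3, pi / 3))"
proof -
  obtain t where t: "t \<in> angle_triples" and p: "p = triangle_class t"
    using assms by (auto simp: triangle_space_def quotient_def triangle_class_def)
  have orbit: "(sine_map ^^ n) t \<in> angle_triples \<and>
      (edge_map ^^ n) p = triangle_class ((sine_map ^^ n) t)" for n
    by (induction n)
      (auto simp: t p sine_map_in_angle_triples edge_map_triangle_class)
  hence "\<forall>n. (sine_map ^^ n) t \<in> (edge_map ^^ n) p"
    using mem_triangle_class by simp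
  moreover have "(pi / 3, pi / 3, pi / 3) \<in> triangle_class (pi / 3, pi / 3, pi / 3)"
    by (rule mem_triangle_class) (simp add: angle_triples_def)
  ultimately show ?thesis
    unfolding triangle_tendsto_def using sine_map_orbit_tendsto[OF t]
    by (intro exI[of _ "\<lambda>n. (sine_map ^^ n) t"] exI[of _ "(pi / 3, pi / 3, pi / 3)"] conjI)
qed

end
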